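(* Let $i:Z\hookrightarrow X$ be a regular or normally oriented closed immersion of real codimension $2r$, with open complement $j:U\hookrightarrow X$ and oriented normal object $N\to Z$ with sphere bundle $\pi:S(N)\to Z$. Assume the purity, excision, orientation and Gysin hypotheses listed in the context, and let $A\in\mathcal C(X)$. Then the secondary boundary group $\mathrm{im}\bigl(\delta:H^{d-1}(U;j^*A)\to H_Z^d(X;A)\bigr)$ is the Euler-kernel term in the Gysin sequence, i.e. it corresponds under the Thom isomorphism to $\ker\bigl(\cup e(N):H^{d-2r}(Z;i^*A)\to H^d(Z;i^*A)\bigr)$. Consequently, if multiplication by the Euler class $$\cup e(N):H^{d-2r}(Z;i^*A)\longrightarrow H^d(Z;i^*A)$$ is injective, then for every class $c\in H^d(X;A)$ with $j^*c=0$ the torsor $\mathrm{Lift}_Z^d(c)$ has a single element.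
   Context: Setting: each space $X$ has a stable triangulated symmetric monoidal category $\mathcal C(X)$ with unit $\mathbf 1_X$, and functors $f^*\dashv f_*$ with $f^*$ symmetric monoidal. For the closed immersion $i:Z\hookrightarrow X$ with open complement $j:U\hookrightarrow X$ the recollement axioms hold: $i^*\dashv i_*\dashv i^!$, $j_!\dashv j^*\dashv j_*$, $i_*,j_!$ fully faithful, $j^*i_*=0$, $i^*j_!=0$, and functorial distinguished triangles $j_!j^*M\to M\to i_*i^*M\xrightarrow{+1}$, $i_*i^!M\to M\to j_*j^*M\xrightarrow{+1}$. Put $H^d(X;A)=\mathrm{Hom}(\mathbf 1_X,A[d])$ and $H^d_Z(X;A)=\mathrm{Hom}(\mathbf 1_X,i_*i^!A[d])$. The localisation long exact sequence is $\cdots\to H_Z^d(X;A)\xrightarrow{\mathrm{forg}}H^d(X;A)\xrightarrow{j^*}H^d(U;j^*A)\xrightarrow{\delta}H_Z^{d+1}(X;A)\to\cdots$, obtained from the triangle $i_*i^!A\to A\to j_*j^*A\xrightarrow{+1}$. The set of supported refinements is $\mathrm{Lift}_Z^d(c)=\{\widetilde c\in H_Z^d(X;A):\mathrm{forg}(\widetilde c)=c\}$; it is a torsor under $\mathrm{im}\,\delta$. Standing hypotheses: (1) Excision / tubular neighbourhood: one may work in a tubular neighbourhood of $Z$ and replace the pair $(X,U)$ (and its localisation sequence) by the disk-bundle pair $(D(N),D(N)\setminus Z)$, where $D(N)\setminus Z$ retracts onto the sphere bundle $S(N)$. (2) Thom isomorphism: $\mathrm{Th}_i:H^{k-2r}(Z;i^*A)\xrightarrow{\sim}H_Z^k(X;A)$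 for all $k$. (3) Exact Gysin sequence of the oriented sphere bundle $\pi:S(N)\to Z$: $$\cdots\to H^{k-1}(S(N);\pi^*i^*A)\xrightarrow{\pi_*}H^{k-2r}(Z;i^*A)\xrightarrow{\cup e(N)}H^{k}(Z;i^*A)\xrightarrow{\pi^*}H^{k}(S(N);\pi^*i^*A)\to\cdots$$ (4) After the excision (1) and the Thom identification (2), the localisation triangle of the pair $(D(N),D(N)\setminus Z)$ is identified with the Gysin triangle of $S(N)\to Z$. Thus $\mathrm{forg}$ corresponds to $\cup e(N)$, restriction to the open complement to $\pi^*$, and $\delta$ to $\pi_*$. *)

theory Defs
  imports "HOL-Algebra.Coset"
begin

section \<open>Triangulated symmetric monoidal categories\<close>

text \<open>
  \<open>g \<cdot> f\<close> is composition "first \<open>f\<close>, then \<open>g\<close>".  All functions are only meaningful on the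
  carriers \<open>Ob\<close> and \<open>Ar\<close>; \<open>Cmp\<close> only on composable pairs.
\<close>

record ('o,'m) cat =
  Ob :: "'o set"
  Ar :: "'m set"
  Dom :: "'m \<Rightarrow> 'o"
  Cod :: "'m \<Rightarrow> 'o"
  Id :: "'o \<Rightarrow> 'm"
  Cmp :: "'m \<Rightarrow> 'm \<Rightarrow> 'm" (infixr "\<cdot>\<index>" 70)

definition Hom :: "('o,'m,'z) cat_scheme \<Rightarrow> 'o \<Rightarrow> 'o \<Rightarrow> 'm set" where
  "Hom C a b = {f \<in> Ar C. Dom C f = a \<and> Cod C f = b}"

locale category_axs =
  fixes C :: "('o,'m,'z) cat_scheme" (structure)
  assumes dom_cod: "f \<in> Ar C \<Longrightarrow> Dom C f \<in> Ob C \<and> Cod C f \<in> Ob C"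
    and id_arr: "a \<in> Ob C \<Longrightarrow> Id C a \<in> Hom C a a"
    and cmp_arr: "\<lbrakk>f \<in> Hom C a b; g \<in> Hom C b c\<rbrakk> \<Longrightarrow> g \<cdot> f \<in> Hom C a c"
    and cmp_assoc: "\<lbrakk>f \<in> Hom C a b; g \<in> Hom C b c; h \<in> Hom C c d\<rbrakk>
                      \<Longrightarrow> (h \<cdot> g) \<cdot> f = h \<cdot> (g \<cdot> f)"
    and id_right: "f \<in> Hom C a b \<Longrightarrow> f \<cdot> Id C a = f"
    and id_left: "f \<in> Hom C a b \<Longrightarrow> Id C b \<cdot> f = f"

definition inverse_arrows :: "('o,'m,'z) cat_scheme \<Rightarrow> 'm \<Rightarrow> 'm \<Rightarrow> bool" where
  "inverse_arrows C f g \<longleftrightarrow> f \<in> Ar C \<and> g \<in> Hom C (Cod C f) (Dom C f) \<and>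
     g \<cdot>\<^bsub>C\<^esub> f = Id C (Dom C f) \<and> f \<cdot>\<^bsub>C\<^esub> g = Id C (Cod C f)"

definition iso_arrow :: "('o,'m,'z) cat_scheme \<Rightarrow> 'm \<Rightarrow> bool" where
  "iso_arrow C f \<longleftrightarrow> (\<exists>g. inverse_arrows C f g)"

definition inv_arrow :: "('o,'m,'z) cat_scheme \<Rightarrow> 'm \<Rightarrow> 'm" where
  "inv_arrow C f = (THE g. inverse_arrows C f g)"

record ('o,'m) fnctr =
  FO :: "'o \<Rightarrow> 'o"
  FA :: "'m \<Rightarrow> 'm"

locale functor_axs =
  fixes C :: "('o,'m,'z) cat_scheme" and D :: "('o,'m,'y) cat_scheme"
    and F :: "('o,'m,'x) fnctr_scheme"
  assumes fun_ob: "a \<in> Ob C \<Longrightarrow> FO F a \<in> Ob D"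
    and fun_arr: "f \<in> Hom C a b \<Longrightarrow> FA F f \<in> Hom D (FO F a) (FO F b)"
    and fun_id: "a \<in> Ob C \<Longrightarrow> FA F (Id C a) = Id D (FO F a)"
    and fun_cmp: "\<lbrakk>f \<in> Hom C a b; g \<in> Hom C b c\<rbrakk>
                    \<Longrightarrow> FA F (g \<cdot>\<^bsub>C\<^esub> f) = FA F g \<cdot>\<^bsub>D\<^esub> FA F f"

definition fully_faithful ::
  "('o,'m,'z) cat_scheme \<Rightarrow> ('o,'m,'y) cat_scheme \<Rightarrow> ('o,'m,'x) fnctr_scheme \<Rightarrow> bool" where
  "fully_faithful C D F \<longleftrightarrow>
     (\<forall>a\<in>Ob C. \<forall>b\<in>Ob C. bij_betw (FA F) (Hom C a b) (Hom D (FO F a) (FO F b)))"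

definition naturally_isomorphic ::
  "('o,'m,'z) cat_scheme \<Rightarrow> ('o,'m,'y) cat_scheme \<Rightarrow> ('o \<Rightarrow> 'o) \<Rightarrow> ('m \<Rightarrow> 'm)
     \<Rightarrow> ('o \<Rightarrow> 'o) \<Rightarrow> ('m \<Rightarrow> 'm) \<Rightarrow> bool" where
  "naturally_isomorphic C D fo fa go ga \<longleftrightarrow>
     (\<exists>\<theta>. (\<forall>a\<in>Ob C. \<theta> a \<in> Hom D (fo a) (go a) \<and> iso_arrow D (\<theta> a)) \<and>
          (\<forall>a\<in>Ob C. \<forall>b\<in>Ob C. \<forall>f\<in>Hom C a b. \<theta> b \<cdot>\<^bsub>D\<^esub> fa f = ga f \<cdot>\<^bsub>D\<^esub> \<theta> a))"

text \<open>
  The translation \<open>Sh\<close> is an automorphism with strict inverse \<open>ShI\<close>, as in Verdier and Neeman.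
  A triangle \<open>a \<rightarrow> b \<rightarrow> c \<rightarrow> Sh a\<close> is recorded as the triple of its arrows.
\<close>

record ('o,'m) tricat = "('o,'m) cat" +
  Add :: "'m \<Rightarrow> 'm \<Rightarrow> 'm"
  Zer :: "'o \<Rightarrow> 'o \<Rightarrow> 'm"
  Sh :: "('o,'m) fnctr"
  ShI :: "('o,'m) fnctr"
  Tri :: "('m \<times> 'm \<times> 'm) set"

definition hom_group :: "('o,'m,'z) tricat_scheme \<Rightarrow> 'o \<Rightarrow> 'o \<Rightarrow> 'm monoid" where
  "hom_group C a b = \<lparr>carrier = Hom C a b, mult = Add C, one = Zer C a b\<rparr>"

definition Neg :: "('o,'m,'z) tricat_scheme \<Rightarrow> 'm \<Rightarrow> 'm" where
  "Neg C f = inv\<^bsub>hom_group C (Dom C f) (Cod C f)\<^esub> f"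

definition zero_object :: "('o,'m,'z) tricat_scheme \<Rightarrow> 'o \<Rightarrow> bool" where
  "zero_object C z \<longleftrightarrow> z \<in> Ob C \<and> Id C z = Zer C z z"

locale additive_category = category_axs C for C :: "('o,'m,'z) tricat_scheme" (structure) +
  assumes hom_abelian: "\<lbrakk>a \<in> Ob C; b \<in> Ob C\<rbrakk> \<Longrightarrow> comm_group (hom_group C a b)"
    and cmp_add_right: "\<lbrakk>f \<in> Hom C a b; f' \<in> Hom C a b; g \<in> Hom C b c\<rbrakk>
                          \<Longrightarrow> g \<cdot> Add C f f' = Add C (g \<cdot> f) (g \<cdot> f')"
    and cmp_add_left: "\<lbrakk>f \<in> Hom C a b; g \<in> Hom C b c; g' \<in> Hom C b c\<rbrakk>
                          \<Longrightarrow> Add C g g' \<cdot> f = Add C (g \<cdot> f) (g' \<cdot> f)"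
    and has_zero: "\<exists>z. zero_object C z"
    and has_biproducts: "\<lbrakk>a \<in> Ob C; b \<in> Ob C\<rbrakk> \<Longrightarrow>
          \<exists>s \<in> Ob C. \<exists>in1 \<in> Hom C a s. \<exists>in2 \<in> Hom C b s. \<exists>pr1 \<in> Hom C s a. \<exists>pr2 \<in> Hom C s b.
            pr1 \<cdot> in1 = Id C a \<and> pr2 \<cdot> in2 = Id C b \<and>
            pr2 \<cdot> in1 = Zer C a b \<and> pr1 \<cdot> in2 = Zer C b a \<and>
            Add C (in1 \<cdot> pr1) (in2 \<cdot> pr2) = Id C s"

definition additive ::
  "('o,'m,'z) tricat_scheme \<Rightarrow> ('o,'m,'y) tricat_scheme \<Rightarrow> ('o,'m,'x) fnctr_scheme \<Rightarrow> bool" where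
  "additive C D F \<longleftrightarrow> (\<forall>a\<in>Ob C. \<forall>b\<in>Ob C. \<forall>f\<in>Hom C a b. \<forall>g\<in>Hom C a b.
     FA F (Add C f g) = Add D (FA F f) (FA F g))"

definition candidate :: "('o,'m,'z) tricat_scheme \<Rightarrow> 'm \<Rightarrow> 'm \<Rightarrow> 'm \<Rightarrow> bool" where
  "candidate C f g h \<longleftrightarrow> f \<in> Ar C \<and> g \<in> Ar C \<and> h \<in> Ar C \<and>
     Dom C g = Cod C f \<and> Dom C h = Cod C g \<and> Cod C h = FO (Sh C) (Dom C f)"

locale triangulated_category = additive_category C
  for C :: "('o,'m,'z) tricat_scheme" (structure) +
  assumes sh_functor: "functor_axs C C (Sh C)" "functor_axs C C (ShI C)"
    and sh_additive: "additive C C (Sh C)"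
    and sh_inv_ob: "a \<in> Ob C \<Longrightarrow> FO (Sh C) (FO (ShI C) a) = a \<and> FO (ShI C) (FO (Sh C) a) = a"
    and sh_inv_arr: "f \<in> Ar C \<Longrightarrow> FA (Sh C) (FA (ShI C) f) = f \<and> FA (ShI C) (FA (Sh C) f) = f"
    and tri_candidate: "(f,g,h) \<in> Tri C \<Longrightarrow> candidate C f g h"
    and TR1_iso: "\<lbrakk>(f,g,h) \<in> Tri C; candidate C f' g' h';
          \<alpha> \<in> Hom C (Dom C f) (Dom C f'); \<beta> \<in> Hom C (Cod C f) (Cod C f');
          \<gamma> \<in> Hom C (Cod C g) (Cod C g');
          iso_arrow C \<alpha>; iso_arrow C \<beta>; iso_arrow C \<gamma>;
          \<beta> \<cdot> f = f' \<cdot> \<alpha>; \<gamma> \<cdot> g = g' \<cdot> \<beta>; FA (Sh C) \<alpha> \<cdot> h = h' \<cdot> \<gamma>\<rbrakk>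
        \<Longrightarrow> (f',g',h') \<in> Tri C"
    and TR1_id: "\<lbrakk>a \<in> Ob C; zero_object C z\<rbrakk>
        \<Longrightarrow> (Id C a, Zer C a z, Zer C z (FO (Sh C) a)) \<in> Tri C"
    and TR1_cone: "f \<in> Ar C \<Longrightarrow> \<exists>g h. (f,g,h) \<in> Tri C"
    and TR2: "candidate C f g h
        \<Longrightarrow> (f,g,h) \<in> Tri C \<longleftrightarrow> (g, h, Neg C (FA (Sh C) f)) \<in> Tri C"
    and TR3: "\<lbrakk>(f,g,h) \<in> Tri C; (f',g',h') \<in> Tri C;
          \<alpha> \<in> Hom C (Dom C f) (Dom C f'); \<beta> \<in> Hom C (Cod C f) (Cod C f'); \<beta> \<cdot> f = f' \<cdot> \<alpha>\<rbrakk>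
        \<Longrightarrow> \<exists>\<gamma> \<in> Hom C (Cod C g) (Cod C g'). \<gamma> \<cdot> g = g' \<cdot> \<beta> \<and> FA (Sh C) \<alpha> \<cdot> h = h' \<cdot> \<gamma>"
    and TR4: "\<lbrakk>f \<in> Hom C a b; g \<in> Hom C b c;
          (f,f1,f2) \<in> Tri C; (g,g1,g2) \<in> Tri C; (g \<cdot> f,h1,h2) \<in> Tri C\<rbrakk>
        \<Longrightarrow> \<exists>u v. (u, v, FA (Sh C) f1 \<cdot> g2) \<in> Tri C \<and>
              u \<cdot> f1 = h1 \<cdot> g \<and> h2 \<cdot> u = f2 \<and> v \<cdot> h1 = g1 \<and> g2 \<cdot> v = FA (Sh C) f \<cdot> h2"

text \<open>\<open>shO C k a = a[k]\<close> and \<open>shA C k f = f[k]\<close> for \<open>k \<in> \<int>\<close>.\<close>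

definition shO :: "('o,'m,'z) tricat_scheme \<Rightarrow> int \<Rightarrow> 'o \<Rightarrow> 'o" where
  "shO C k a = (if 0 \<le> k then (FO (Sh C) ^^ nat k) a else (FO (ShI C) ^^ nat (- k)) a)"

definition shA :: "('o,'m,'z) tricat_scheme \<Rightarrow> int \<Rightarrow> 'm \<Rightarrow> 'm" where
  "shA C k f = (if 0 \<le> k then (FA (Sh C) ^^ nat k) f else (FA (ShI C) ^^ nat (- k)) f)"

text \<open>\<open>Ksh F a : F (Sh a) \<rightarrow> Sh (F a)\<close> is the shift comparison of an exact functor.\<close>

record ('o,'m) xfun = "('o,'m) fnctr" +
  Ksh :: "'o \<Rightarrow> 'm"

locale exact_functor = functor_axs C D F
  for C :: "('o,'m,'z) tricat_scheme" and D :: "('o,'m,'y) tricat_scheme"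
    and F :: "('o,'m,'x) xfun_scheme" +
  assumes fun_additive: "additive C D F"
    and ksh_arr: "a \<in> Ob C \<Longrightarrow> Ksh F a \<in> Hom D (FO F (FO (Sh C) a)) (FO (Sh D) (FO F a))"
    and ksh_iso: "a \<in> Ob C \<Longrightarrow> iso_arrow D (Ksh F a)"
    and ksh_nat: "f \<in> Hom C a b \<Longrightarrow>
          Ksh F b \<cdot>\<^bsub>D\<^esub> FA F (FA (Sh C) f) = FA (Sh D) (FA F f) \<cdot>\<^bsub>D\<^esub> Ksh F a"
    and fun_tri: "(f,g,h) \<in> Tri C \<Longrightarrow> (FA F f, FA F g, Ksh F (Dom C f) \<cdot>\<^bsub>D\<^esub> FA F h) \<in> Tri D"

text \<open>The iterated comparison \<open>kap C D F k a : F (a[k]) \<rightarrow> (F a)[k]\<close>.\<close>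

primrec kap_pos ::
  "('o,'m,'z) tricat_scheme \<Rightarrow> ('o,'m,'y) tricat_scheme \<Rightarrow> ('o,'m,'x) xfun_scheme
     \<Rightarrow> nat \<Rightarrow> 'o \<Rightarrow> 'm" where
  "kap_pos C D F 0 a = Id D (FO F a)"
| "kap_pos C D F (Suc n) a =
     FA (Sh D) (kap_pos C D F n a) \<cdot>\<^bsub>D\<^esub> Ksh F ((FO (Sh C) ^^ n) a)"

primrec kap_neg ::
  "('o,'m,'z) tricat_scheme \<Rightarrow> ('o,'m,'y) tricat_scheme \<Rightarrow> ('o,'m,'x) xfun_scheme
     \<Rightarrow> nat \<Rightarrow> 'o \<Rightarrow> 'm" where
  "kap_neg C D F 0 a = Id D (FO F a)"
| "kap_neg C D F (Suc n) a =
     FA (ShI D) (kap_neg C D F n a)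
       \<cdot>\<^bsub>D\<^esub> FA (ShI D) (inv_arrow D (Ksh F ((FO (ShI C) ^^ Suc n) a)))"

definition kap ::
  "('o,'m,'z) tricat_scheme \<Rightarrow> ('o,'m,'y) tricat_scheme \<Rightarrow> ('o,'m,'x) xfun_scheme
     \<Rightarrow> int \<Rightarrow> 'o \<Rightarrow> 'm" where
  "kap C D F k a = (if 0 \<le> k then kap_pos C D F (nat k) a else kap_neg C D F (nat (- k)) a)"

text \<open>
  An adjunction \<open>L \<stileturn> R\<close> of exact functors, given by unit \<open>un\<close> and counit \<open>cu\<close> compatible with the
  shift comparisons.
\<close>

locale exact_adjunction =
  L: exact_functor C D L + R: exact_functor D C R
  for C :: "('o,'m,'z) tricat_scheme" and D :: "('o,'m,'y) tricat_scheme"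
    and L :: "('o,'m,'x) xfun_scheme" and R :: "('o,'m,'w) xfun_scheme"
    and un :: "'o \<Rightarrow> 'm" and cu :: "'o \<Rightarrow> 'm" +
  assumes un_arr: "a \<in> Ob C \<Longrightarrow> un a \<in> Hom C a (FO R (FO L a))"
    and cu_arr: "b \<in> Ob D \<Longrightarrow> cu b \<in> Hom D (FO L (FO R b)) b"
    and un_nat: "f \<in> Hom C a a' \<Longrightarrow> un a' \<cdot>\<^bsub>C\<^esub> f = FA R (FA L f) \<cdot>\<^bsub>C\<^esub> un a"
    and cu_nat: "g \<in> Hom D b b' \<Longrightarrow> cu b' \<cdot>\<^bsub>D\<^esub> FA L (FA R g) = g \<cdot>\<^bsub>D\<^esub> cu b"
    and triangle_L: "a \<in> Ob C \<Longrightarrow> cu (FO L a) \<cdot>\<^bsub>D\<^esub> FA L (un a) = Id D (FO L a)"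
    and triangle_R: "b \<in> Ob D \<Longrightarrow> FA R (cu b) \<cdot>\<^bsub>C\<^esub> un (FO R b) = Id C (FO R b)"
    and un_shift: "a \<in> Ob C \<Longrightarrow>
          Ksh R (FO L a) \<cdot>\<^bsub>C\<^esub> FA R (Ksh L a) \<cdot>\<^bsub>C\<^esub> un (FO (Sh C) a) = FA (Sh C) (un a)"
    and cu_shift: "b \<in> Ob D \<Longrightarrow>
          FA (Sh D) (cu b) \<cdot>\<^bsub>D\<^esub> Ksh L (FO R b) \<cdot>\<^bsub>D\<^esub> FA L (Ksh R b) = cu (FO (Sh D) b)"

text \<open>
  \<open>\<boxtimes>\<close> and \<open>\<boxdot>\<close> are the tensor product on objects and on arrows;
  \<open>asc a b c : (a \<boxtimes> b) \<boxtimes> c \<rightarrow> a \<boxtimes> (b \<boxtimes> c)\<close>, \<open>lun a : \<one> \<boxtimes> a \<rightarrow> a\<close>, \<open>run a : a \<boxtimes> \<one> \<rightarrow> a\<close>,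
  \<open>bra a b : a \<boxtimes> b \<rightarrow> b \<boxtimes> a\<close> and \<open>tsh a b : a \<boxtimes> Sh b \<rightarrow> Sh (a \<boxtimes> b)\<close>.
\<close>

record ('o,'m) ttcat = "('o,'m) tricat" +
  tenO :: "'o \<Rightarrow> 'o \<Rightarrow> 'o" (infixr "\<boxtimes>\<index>" 75)
  tenA :: "'m \<Rightarrow> 'm \<Rightarrow> 'm" (infixr "\<boxdot>\<index>" 75)
  unit :: "'o"
  asc :: "'o \<Rightarrow> 'o \<Rightarrow> 'o \<Rightarrow> 'm"
  lun :: "'o \<Rightarrow> 'm"
  run :: "'o \<Rightarrow> 'm"
  bra :: "'o \<Rightarrow> 'o \<Rightarrow> 'm"
  tsh :: "'o \<Rightarrow> 'o \<Rightarrow> 'm"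

locale symmetric_monoidal = category_axs C for C :: "('o,'m,'z) ttcat_scheme" (structure) +
  assumes unit_ob: "unit C \<in> Ob C"
    and ten_ob: "\<lbrakk>a \<in> Ob C; b \<in> Ob C\<rbrakk> \<Longrightarrow> a \<boxtimes> b \<in> Ob C"
    and ten_arr: "\<lbrakk>f \<in> Hom C a a'; g \<in> Hom C b b'\<rbrakk> \<Longrightarrow> f \<boxdot> g \<in> Hom C (a \<boxtimes> b) (a' \<boxtimes> b')"
    and ten_id: "\<lbrakk>a \<in> Ob C; b \<in> Ob C\<rbrakk> \<Longrightarrow> Id C a \<boxdot> Id C b = Id C (a \<boxtimes> b)"
    and ten_cmp: "\<lbrakk>f \<in> Hom C a a'; f' \<in> Hom C a' a''; g \<in> Hom C b b'; g' \<in> Hom C b' b''\<rbrakk>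
          \<Longrightarrow> (f' \<cdot> f) \<boxdot> (g' \<cdot> g) = (f' \<boxdot> g') \<cdot> (f \<boxdot> g)"
    and asc_iso: "\<lbrakk>a \<in> Ob C; b \<in> Ob C; c \<in> Ob C\<rbrakk> \<Longrightarrow>
          asc C a b c \<in> Hom C ((a \<boxtimes> b) \<boxtimes> c) (a \<boxtimes> (b \<boxtimes> c)) \<and> iso_arrow C (asc C a b c)"
    and lun_iso: "a \<in> Ob C \<Longrightarrow> lun C a \<in> Hom C (unit C \<boxtimes> a) a \<and> iso_arrow C (lun C a)"
    and run_iso: "a \<in> Ob C \<Longrightarrow> run C a \<in> Hom C (a \<boxtimes> unit C) a \<and> iso_arrow C (run C a)"
    and bra_arr: "\<lbrakk>a \<in> Ob C; b \<in> Ob C\<rbrakk> \<Longrightarrow> bra C a b \<in> Hom C (a \<boxtimes> b) (b \<boxtimes> a)"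
    and asc_nat: "\<lbrakk>f \<in> Hom C a a'; g \<in> Hom C b b'; h \<in> Hom C c c'\<rbrakk> \<Longrightarrow>
          asc C a' b' c' \<cdot> ((f \<boxdot> g) \<boxdot> h) = (f \<boxdot> (g \<boxdot> h)) \<cdot> asc C a b c"
    and lun_nat: "f \<in> Hom C a a' \<Longrightarrow> lun C a' \<cdot> (Id C (unit C) \<boxdot> f) = f \<cdot> lun C a"
    and run_nat: "f \<in> Hom C a a' \<Longrightarrow> run C a' \<cdot> (f \<boxdot> Id C (unit C)) = f \<cdot> run C a"
    and bra_nat: "\<lbrakk>f \<in> Hom C a a'; g \<in> Hom C b b'\<rbrakk> \<Longrightarrow>
          bra C a' b' \<cdot> (f \<boxdot> g) = (g \<boxdot> f) \<cdot> bra C a b"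
    and pentagon: "\<lbrakk>a \<in> Ob C; b \<in> Ob C; c \<in> Ob C; d \<in> Ob C\<rbrakk> \<Longrightarrow>
          asc C a b (c \<boxtimes> d) \<cdot> asc C (a \<boxtimes> b) c d =
          (Id C a \<boxdot> asc C b c d) \<cdot> asc C a (b \<boxtimes> c) d \<cdot> (asc C a b c \<boxdot> Id C d)"
    and unit_triangle: "\<lbrakk>a \<in> Ob C; b \<in> Ob C\<rbrakk> \<Longrightarrow>
          (Id C a \<boxdot> lun C b) \<cdot> asc C a (unit C) b = run C a \<boxdot> Id C b"
    and hexagon: "\<lbrakk>a \<in> Ob C; b \<in> Ob C; c \<in> Ob C\<rbrakk> \<Longrightarrow>
          asc C b c a \<cdot> bra C a (b \<boxtimes> c) \<cdot> asc C a b c =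
          (Id C b \<boxdot> bra C a c) \<cdot> asc C b a c \<cdot> (bra C a b \<boxdot> Id C c)"
    and symmetry: "\<lbrakk>a \<in> Ob C; b \<in> Ob C\<rbrakk> \<Longrightarrow> bra C b a \<cdot> bra C a b = Id C (a \<boxtimes> b)"

text \<open>Compatibility of tensor product and triangulation as in Hovey--Palmieri--Strickland, A.2.\<close>

locale tensor_triangulated = triangulated_category C + symmetric_monoidal C
  for C :: "('o,'m,'z) ttcat_scheme" (structure) +
  assumes ten_add_right: "\<lbrakk>f \<in> Hom C a a'; g \<in> Hom C b b'; g' \<in> Hom C b b'\<rbrakk> \<Longrightarrow>
          f \<boxdot> Add C g g' = Add C (f \<boxdot> g) (f \<boxdot> g')"
    and ten_add_left: "\<lbrakk>f \<in> Hom C a a'; f' \<in> Hom C a a'; g \<in> Hom C b b'\<rbrakk> \<Longrightarrow>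
          Add C f f' \<boxdot> g = Add C (f \<boxdot> g) (f' \<boxdot> g)"
    and tsh_iso: "\<lbrakk>a \<in> Ob C; b \<in> Ob C\<rbrakk> \<Longrightarrow>
          tsh C a b \<in> Hom C (a \<boxtimes> FO (Sh C) b) (FO (Sh C) (a \<boxtimes> b)) \<and> iso_arrow C (tsh C a b)"
    and tsh_nat: "\<lbrakk>f \<in> Hom C a a'; g \<in> Hom C b b'\<rbrakk> \<Longrightarrow>
          tsh C a' b' \<cdot> (f \<boxdot> FA (Sh C) g) = FA (Sh C) (f \<boxdot> g) \<cdot> tsh C a b"
    and ten_tri: "\<lbrakk>a \<in> Ob C; (f,g,h) \<in> Tri C\<rbrakk> \<Longrightarrow>
          (Id C a \<boxdot> f, Id C a \<boxdot> g, tsh C a (Dom C f) \<cdot> (Id C a \<boxdot> h)) \<in> Tri C"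
    and tsh_unit: "b \<in> Ob C \<Longrightarrow>
          FA (Sh C) (lun C b) \<cdot> tsh C (unit C) b = lun C (FO (Sh C) b)"
    and tsh_asc: "\<lbrakk>a \<in> Ob C; b \<in> Ob C; c \<in> Ob C\<rbrakk> \<Longrightarrow>
          FA (Sh C) (asc C a b c) \<cdot> tsh C (a \<boxtimes> b) c =
          tsh C a (b \<boxtimes> c) \<cdot> (Id C a \<boxdot> tsh C b c) \<cdot> asc C a b (FO (Sh C) c)"
    and twist_sign: "bra C (FO (Sh C) (unit C)) (FO (Sh C) (unit C)) =
          Neg C (Id C (FO (Sh C) (unit C) \<boxtimes> FO (Sh C) (unit C)))"

text \<open>\<open>tsh_pow C n a b : a \<boxtimes> b[n] \<rightarrow> (a \<boxtimes> b)[n]\<close>.\<close>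

primrec tsh_pow :: "('o,'m,'z) ttcat_scheme \<Rightarrow> nat \<Rightarrow> 'o \<Rightarrow> 'o \<Rightarrow> 'm" where
  "tsh_pow C 0 a b = Id C (a \<boxtimes>\<^bsub>C\<^esub> b)"
| "tsh_pow C (Suc n) a b =
     FA (Sh C) (tsh_pow C n a b) \<cdot>\<^bsub>C\<^esub> tsh C a ((FO (Sh C) ^^ n) b)"

text \<open>\<open>mu a b : F a \<boxtimes> F b \<rightarrow> F (a \<boxtimes> b)\<close> and \<open>ep : \<one> \<rightarrow> F \<one>\<close> make \<open>F\<close> strong symmetric monoidal.\<close>

locale symmetric_monoidal_exact_functor = exact_functor C D F
  for C :: "('o,'m,'z) ttcat_scheme" and D :: "('o,'m,'y) ttcat_scheme"
    and F :: "('o,'m,'x) xfun_scheme" and mu :: "'o \<Rightarrow> 'o \<Rightarrow> 'm" and ep :: 'm +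
  assumes ep_iso: "ep \<in> Hom D (unit D) (FO F (unit C)) \<and> iso_arrow D ep"
    and mu_iso: "\<lbrakk>a \<in> Ob C; b \<in> Ob C\<rbrakk> \<Longrightarrow>
          mu a b \<in> Hom D (FO F a \<boxtimes>\<^bsub>D\<^esub> FO F b) (FO F (a \<boxtimes>\<^bsub>C\<^esub> b)) \<and> iso_arrow D (mu a b)"
    and mu_nat: "\<lbrakk>f \<in> Hom C a a'; g \<in> Hom C b b'\<rbrakk> \<Longrightarrow>
          mu a' b' \<cdot>\<^bsub>D\<^esub> (FA F f \<boxdot>\<^bsub>D\<^esub> FA F g) = FA F (f \<boxdot>\<^bsub>C\<^esub> g) \<cdot>\<^bsub>D\<^esub> mu a b"
    and mu_asc: "\<lbrakk>a \<in> Ob C; b \<in> Ob C; c \<in> Ob C\<rbrakk> \<Longrightarrow>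
          FA F (asc C a b c) \<cdot>\<^bsub>D\<^esub> mu (a \<boxtimes>\<^bsub>C\<^esub> b) c \<cdot>\<^bsub>D\<^esub> (mu a b \<boxdot>\<^bsub>D\<^esub> Id D (FO F c)) =
          mu a (b \<boxtimes>\<^bsub>C\<^esub> c) \<cdot>\<^bsub>D\<^esub> (Id D (FO F a) \<boxdot>\<^bsub>D\<^esub> mu b c) \<cdot>\<^bsub>D\<^esub> asc D (FO F a) (FO F b) (FO F c)"
    and mu_unit: "a \<in> Ob C \<Longrightarrow>
          FA F (lun C a) \<cdot>\<^bsub>D\<^esub> mu (unit C) a \<cdot>\<^bsub>D\<^esub> (ep \<boxdot>\<^bsub>D\<^esub> Id D (FO F a)) = lun D (FO F a)"
    and mu_bra: "\<lbrakk>a \<in> Ob C; b \<in> Ob C\<rbrakk> \<Longrightarrow>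
          FA F (bra C a b) \<cdot>\<^bsub>D\<^esub> mu a b = mu b a \<cdot>\<^bsub>D\<^esub> bra D (FO F a) (FO F b)"
    and mu_tsh: "\<lbrakk>a \<in> Ob C; b \<in> Ob C\<rbrakk> \<Longrightarrow>
          Ksh F (a \<boxtimes>\<^bsub>C\<^esub> b) \<cdot>\<^bsub>D\<^esub> FA F (tsh C a b) \<cdot>\<^bsub>D\<^esub> mu a (FO (Sh C) b) =
          FA (Sh D) (mu a b) \<cdot>\<^bsub>D\<^esub> tsh D (FO F a) (FO F b) \<cdot>\<^bsub>D\<^esub> (Id D (FO F a) \<boxdot>\<^bsub>D\<^esub> Ksh F b)"

section \<open>Coefficient categories over spaces, recollement, cohomology\<close>

text \<open>
  For \<open>f : X \<rightarrow> Y\<close> in the category \<open>Sp\<close> of spaces, \<open>pull f = f\<^sup>* : C(Y) \<rightarrow> C(X)\<close> and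
  \<open>push f = f\<^sub>*\<close>, with unit \<open>punit f\<close> and counit \<open>pcounit f\<close>; \<open>pmu f\<close> and \<open>peps f\<close> are the
  monoidal structure of \<open>f\<^sup>*\<close>.  One pair of types \<open>'o\<close>, \<open>'m\<close> carries all the categories \<open>C(X)\<close>.
\<close>

record ('s,'f,'o,'m) coefficients =
  Sp :: "('s,'f) cat"
  Cf :: "'s \<Rightarrow> ('o,'m) ttcat"
  pull :: "'f \<Rightarrow> ('o,'m) xfun"
  push :: "'f \<Rightarrow> ('o,'m) xfun"
  punit :: "'f \<Rightarrow> 'o \<Rightarrow> 'm"
  pcounit :: "'f \<Rightarrow> 'o \<Rightarrow> 'm"
  pmu :: "'f \<Rightarrow> 'o \<Rightarrow> 'o \<Rightarrow> 'm"
  peps :: "'f \<Rightarrow> 'm"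

locale coefficient_system =
  fixes K :: "('s,'f,'o,'m) coefficients"
  assumes spaces: "category_axs (Sp K)"
    and coeff_cat: "X \<in> Ob (Sp K) \<Longrightarrow> tensor_triangulated (Cf K X)"
    and pull_push: "f \<in> Hom (Sp K) X Y \<Longrightarrow>
          exact_adjunction (Cf K Y) (Cf K X) (pull K f) (push K f) (punit K f) (pcounit K f)"
    and pull_monoidal: "f \<in> Hom (Sp K) X Y \<Longrightarrow>
          symmetric_monoidal_exact_functor (Cf K Y) (Cf K X) (pull K f) (pmu K f) (peps K f)"
    and pull_id: "X \<in> Ob (Sp K) \<Longrightarrow> naturally_isomorphic (Cf K X) (Cf K X)
          (FO (pull K (Id (Sp K) X))) (FA (pull K (Id (Sp K) X))) (\<lambda>a. a) (\<lambda>f. f)"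
    and pull_cmp: "\<lbrakk>f \<in> Hom (Sp K) X Y; g \<in> Hom (Sp K) Y W\<rbrakk> \<Longrightarrow>
          naturally_isomorphic (Cf K W) (Cf K X)
            (FO (pull K (g \<cdot>\<^bsub>Sp K\<^esub> f))) (FA (pull K (g \<cdot>\<^bsub>Sp K\<^esub> f)))
            (\<lambda>a. FO (pull K f) (FO (pull K g) a)) (\<lambda>h. FA (pull K f) (FA (pull K g) h))"

text \<open>
  A closed immersion \<open>cl\<close> with open complement \<open>op\<close> and the remaining recollement functors
  \<open>ups = i\<^sup>!\<close>, \<open>lsh = j\<^sub>!\<close>; \<open>bdl M : i\<^sub>* i\<^sup>* M \<rightarrow> (j\<^sub>! j\<^sup>* M)[1]\<close> and \<open>bdr M : j\<^sub>* j\<^sup>* M \<rightarrow> (i\<^sub>* i\<^sup>! M)[1]\<close>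
  are the connecting morphisms of the two functorial triangles.
\<close>

record ('f,'o,'m) closed_open =
  cl :: 'f
  op :: 'f
  ups :: "('o,'m) xfun"
  lsh :: "('o,'m) xfun"
  ups_unit :: "'o \<Rightarrow> 'm"
  ups_counit :: "'o \<Rightarrow> 'm"
  lsh_unit :: "'o \<Rightarrow> 'm"
  lsh_counit :: "'o \<Rightarrow> 'm"
  bdl :: "'o \<Rightarrow> 'm"
  bdr :: "'o \<Rightarrow> 'm"

locale recollement =
  fixes K :: "('s,'f,'o,'m) coefficients" and Z X U :: 's and R :: "('f,'o,'m) closed_open"
  assumes cl_arr: "cl R \<in> Hom (Sp K) Z X" and op_arr: "op R \<in> Hom (Sp K) U X"
    and adj_ups: "exact_adjunction (Cf K Z) (Cf K X) (push K (cl R)) (ups R)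
                    (ups_unit R) (ups_counit R)"
    and adj_lsh: "exact_adjunction (Cf K U) (Cf K X) (lsh R) (pull K (op R))
                    (lsh_unit R) (lsh_counit R)"
    and ff_cl: "fully_faithful (Cf K Z) (Cf K X) (push K (cl R))"
    and ff_lsh: "fully_faithful (Cf K U) (Cf K X) (lsh R)"
    and op_cl_zero: "M \<in> Ob (Cf K Z) \<Longrightarrow>
          zero_object (Cf K U) (FO (pull K (op R)) (FO (push K (cl R)) M))"
    and cl_lsh_zero: "M \<in> Ob (Cf K U) \<Longrightarrow>
          zero_object (Cf K Z) (FO (pull K (cl R)) (FO (lsh R) M))"
    and tri_left: "M \<in> Ob (Cf K X) \<Longrightarrow>
          (lsh_counit R M, punit K (cl R) M, bdl R M) \<in> Tri (Cf K X)"
    and tri_right: "M \<in> Ob (Cf K X) \<Longrightarrow>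
          (ups_counit R M, punit K (op R) M, bdr R M) \<in> Tri (Cf K X)"
    and bdl_nat: "f \<in> Hom (Cf K X) M M' \<Longrightarrow>
          bdl R M' \<cdot>\<^bsub>Cf K X\<^esub> FA (push K (cl R)) (FA (pull K (cl R)) f) =
          FA (Sh (Cf K X)) (FA (lsh R) (FA (pull K (op R)) f)) \<cdot>\<^bsub>Cf K X\<^esub> bdl R M"
    and bdr_nat: "f \<in> Hom (Cf K X) M M' \<Longrightarrow>
          bdr R M' \<cdot>\<^bsub>Cf K X\<^esub> FA (push K (op R)) (FA (pull K (op R)) f) =
          FA (Sh (Cf K X)) (FA (push K (cl R)) (FA (ups R) f)) \<cdot>\<^bsub>Cf K X\<^esub> bdr R M"

definition coh :: "('s,'f,'o,'m) coefficients \<Rightarrow> 's \<Rightarrow> 'o \<Rightarrow> int \<Rightarrow> 'm monoid" where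
  "coh K X B k = hom_group (Cf K X) (unit (Cf K X)) (shO (Cf K X) k B)"

definition supp_obj :: "('s,'f,'o,'m) coefficients \<Rightarrow> ('f,'o,'m) closed_open \<Rightarrow> 'o \<Rightarrow> 'o" where
  "supp_obj K R B = FO (push K (cl R)) (FO (ups R) B)"

definition supp_coh ::
  "('s,'f,'o,'m) coefficients \<Rightarrow> 's \<Rightarrow> ('f,'o,'m) closed_open \<Rightarrow> 'o \<Rightarrow> int \<Rightarrow> 'm monoid" where
  "supp_coh K X R B k = coh K X (supp_obj K R B) k"

definition forg ::
  "('s,'f,'o,'m) coefficients \<Rightarrow> 's \<Rightarrow> ('f,'o,'m) closed_open \<Rightarrow> 'o \<Rightarrow> int \<Rightarrow> 'm \<Rightarrow> 'm" where
  "forg K X R B k x = shA (Cf K X) k (ups_counit R B) \<cdot>\<^bsub>Cf K X\<^esub> x"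

text \<open>
  \<open>f\<^sup>* : H\<^sup>k(Y;B) \<rightarrow> H\<^sup>k(X;f\<^sup>*B)\<close> sends \<open>x\<close> to \<open>\<one> \<rightarrow> f\<^sup>*\<one> \<rightarrow> f\<^sup>*(B[k]) \<rightarrow> (f\<^sup>*B)[k]\<close>.
\<close>

definition res :: "('s,'f,'o,'m) coefficients \<Rightarrow> 'f \<Rightarrow> 'o \<Rightarrow> int \<Rightarrow> 'm \<Rightarrow> 'm" where
  "res K f B k x =
     (let CX = Cf K (Dom (Sp K) f); CY = Cf K (Cod (Sp K) f) in
      kap CY CX (pull K f) k B \<cdot>\<^bsub>CX\<^esub> FA (pull K f) x \<cdot>\<^bsub>CX\<^esub> peps K f)"

text \<open>
  The adjunction identification \<open>H\<^sup>k(U;j\<^sup>*B) \<rightarrow> Hom(\<one>\<^sub>X, (j\<^sub>*j\<^sup>*B)[k])\<close>, sending \<open>y\<close> to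
  \<open>\<one> \<rightarrow> j\<^sub>*j\<^sup>*\<one> \<rightarrow> j\<^sub>*\<one> \<rightarrow> j\<^sub>*((j\<^sup>*B)[k]) \<rightarrow> (j\<^sub>*j\<^sup>*B)[k]\<close>.
\<close>

definition to_open ::
  "('s,'f,'o,'m) coefficients \<Rightarrow> 's \<Rightarrow> 's \<Rightarrow> ('f,'o,'m) closed_open \<Rightarrow> 'o \<Rightarrow> int \<Rightarrow> 'm \<Rightarrow> 'm" where
  "to_open K X U R B k y =
     kap (Cf K U) (Cf K X) (push K (op R)) k (FO (pull K (op R)) B)
       \<cdot>\<^bsub>Cf K X\<^esub> FA (push K (op R)) y
       \<cdot>\<^bsub>Cf K X\<^esub> FA (push K (op R)) (inv_arrow (Cf K U) (peps K (op R)))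
       \<cdot>\<^bsub>Cf K X\<^esub> punit K (op R) (unit (Cf K X))"

text \<open>\<open>delta \<dots> k\<close> has target degree \<open>k\<close>: it maps \<open>H\<^sup>k\<^sup>-\<^sup>1(U;j\<^sup>*B)\<close> to \<open>H\<^sub>Z\<^sup>k(X;B)\<close>.\<close>

definition delta ::
  "('s,'f,'o,'m) coefficients \<Rightarrow> 's \<Rightarrow> 's \<Rightarrow> ('f,'o,'m) closed_open \<Rightarrow> 'o \<Rightarrow> int \<Rightarrow> 'm \<Rightarrow> 'm" where
  "delta K X U R B k y = shA (Cf K X) (k - 1) (bdr R B) \<cdot>\<^bsub>Cf K X\<^esub> to_open K X U R B (k - 1) y"

definition Lift ::
  "('s,'f,'o,'m) coefficients \<Rightarrow> 's \<Rightarrow> ('f,'o,'m) closed_open \<Rightarrow> 'o \<Rightarrow> int \<Rightarrow> 'm \<Rightarrow> 'm set" where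
  "Lift K X R B d c = {c' \<in> carrier (supp_coh K X R B d). forg K X R B d c' = c}"

text \<open>
  The product \<open>H\<^sup>k(X;B) \<times> H\<^sup>n(X;\<one>) \<rightarrow> H\<^sup>k\<^sup>+\<^sup>n(X;B)\<close>, sending \<open>(x, y)\<close> to
  \<open>\<one> \<rightarrow> \<one> \<boxtimes> \<one> \<rightarrow> B[k] \<boxtimes> \<one>[n] \<rightarrow> (B[k] \<boxtimes> \<one>)[n] \<rightarrow> B[k][n]\<close>.
\<close>

definition cup ::
  "('s,'f,'o,'m) coefficients \<Rightarrow> 's \<Rightarrow> 'o \<Rightarrow> int \<Rightarrow> nat \<Rightarrow> 'm \<Rightarrow> 'm \<Rightarrow> 'm" where
  "cup K X B k n x y =
     (let C = Cf K X; Bk = shO C k B in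
      shA C (int n) (run C Bk) \<cdot>\<^bsub>C\<^esub> tsh_pow C n Bk (unit C) \<cdot>\<^bsub>C\<^esub> (x \<boxdot>\<^bsub>C\<^esub> y)
        \<cdot>\<^bsub>C\<^esub> inv_arrow C (lun C (unit C)))"

section \<open>The normal object, its disk and sphere bundle, and the standing hypotheses\<close>

text \<open>
  \<open>nrm : N \<rightarrow> Z\<close> with zero section \<open>nzero\<close>; \<open>dinc : D(N) \<rightarrow> N\<close>; \<open>dzero : Z \<rightarrow> D(N)\<close>;
  \<open>dopen : D(N) - Z \<rightarrow> D(N)\<close>; \<open>tube : D(N) \<rightarrow> X\<close> the tubular neighbourhood, restricting to
  \<open>tubeU : D(N) - Z \<rightarrow> U\<close>; \<open>sph = \<pi> : S(N) \<rightarrow> Z\<close>; \<open>sinc : S(N) \<rightarrow> D(N) - Z\<close> with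
  retraction \<open>sret\<close>.
\<close>

record 'f normal_data =
  nrm :: 'f
  nzero :: 'f
  dinc :: 'f
  dzero :: 'f
  dopen :: 'f
  tube :: 'f
  tubeU :: 'f
  sph :: 'f
  sinc :: 'f
  sret :: 'f

locale normal_geometry =
  fixes Spc :: "('s,'f) cat" (structure) and Z X U N D V S :: 's and i j :: 'f
    and G :: "'f normal_data"
  assumes nrm_arr: "nrm G \<in> Hom Spc N Z" and nzero_arr: "nzero G \<in> Hom Spc Z N"
    and dinc_arr: "dinc G \<in> Hom Spc D N" and dzero_arr: "dzero G \<in> Hom Spc Z D"
    and dopen_arr: "dopen G \<in> Hom Spc V D"
    and tube_arr: "tube G \<in> Hom Spc D X" and tubeU_arr: "tubeU G \<in> Hom Spc V U"
    and sph_arr: "sph G \<in> Hom Spc S Z" and sinc_arr: "sinc G \<in> Hom Spc S V"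
    and sret_arr: "sret G \<in> Hom Spc V S"
    and zero_section: "nrm G \<cdot> nzero G = Id Spc Z"
    and zero_in_disk: "dinc G \<cdot> dzero G = nzero G"
    and tube_on_Z: "tube G \<cdot> dzero G = i"
    and tube_on_V: "tube G \<cdot> dopen G = j \<cdot> tubeU G"
    and retraction: "sret G \<cdot> sinc G = Id Spc S"
    and sphere_over: "sph G = nrm G \<cdot> dinc G \<cdot> dopen G \<cdot> sinc G"
    and retraction_over: "sph G \<cdot> sret G = nrm G \<cdot> dinc G \<cdot> dopen G"

text \<open>
  An orientation of the normal object of rank \<open>2r\<close> is a Thom class: a class
  \<open>th \<in> H\<^sub>Z\<^sup>2\<^sup>r(D(N);\<one>)\<close> whose adjoint \<open>\<one>\<^sub>Z \<rightarrow> s\<^sup>!\<one>[2r]\<close> is invertible, \<open>s\<close> being the zero section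
  \<open>cl RD\<close>.  The Euler class is the restriction of \<open>th\<close> to the zero section.
\<close>

definition thom_class ::
  "('s,'f,'o,'m) coefficients \<Rightarrow> 's \<Rightarrow> 's \<Rightarrow> ('f,'o,'m) closed_open \<Rightarrow> nat \<Rightarrow> 'm \<Rightarrow> bool" where
  "thom_class K Z D RD r th \<longleftrightarrow>
     th \<in> carrier (supp_coh K D RD (unit (Cf K D)) (2 * int r)) \<and>
     iso_arrow (Cf K Z)
       (shA (Cf K Z) (2 * int r) (pcounit K (cl RD) (FO (ups RD) (unit (Cf K D))))
          \<cdot>\<^bsub>Cf K Z\<^esub> res K (cl RD) (supp_obj K RD (unit (Cf K D))) (2 * int r) th)"

definition euler_class ::
  "('s,'f,'o,'m) coefficients \<Rightarrow> 's \<Rightarrow> 's \<Rightarrow> ('f,'o,'m) closed_open \<Rightarrow> nat \<Rightarrow> 'm \<Rightarrow> 'm" where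
  "euler_class K Z D RD r th =
     shA (Cf K Z) (2 * int r) (inv_arrow (Cf K Z) (peps K (cl RD)))
       \<cdot>\<^bsub>Cf K Z\<^esub> res K (cl RD) (unit (Cf K D)) (2 * int r)
            (forg K D RD (unit (Cf K D)) (2 * int r) th)"

text \<open>\<open>cup_euler \<dots> k : H\<^sup>k\<^sup>-\<^sup>2\<^sup>r(Z;B) \<rightarrow> H\<^sup>k(Z;B)\<close>.\<close>

definition cup_euler ::
  "('s,'f,'o,'m) coefficients \<Rightarrow> 's \<Rightarrow> 's \<Rightarrow> ('f,'o,'m) closed_open \<Rightarrow> nat \<Rightarrow> 'm \<Rightarrow> 'o
     \<Rightarrow> int \<Rightarrow> 'm \<Rightarrow> 'm" where
  "cup_euler K Z D RD r th B k x =
     cup K Z B (k - 2 * int r) (2 * r) x (euler_class K Z D RD r th)"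

definition exact_at ::
  "'m monoid \<Rightarrow> ('m \<Rightarrow> 'm) \<Rightarrow> 'm monoid \<Rightarrow> ('m \<Rightarrow> 'm) \<Rightarrow> 'm monoid \<Rightarrow> bool" where
  "exact_at A f B g C \<longleftrightarrow> f \<in> hom A B \<and> g \<in> hom B C \<and> f ` carrier A = kernel B C g"

text \<open>
  Excision: an isomorphism \<open>(eZ, eX, eU)\<close> of the localisation sequences of \<open>(X, U)\<close> with
  coefficients \<open>A\<close> and of \<open>(D(N), D(N) - Z)\<close> with coefficients \<open>A\<close> restricted to \<open>D(N)\<close>.
\<close>

definition excision ::
  "('s,'f,'o,'m) coefficients \<Rightarrow> 's \<Rightarrow> 's \<Rightarrow> 's \<Rightarrow> 's \<Rightarrow> ('f,'o,'m) closed_open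
     \<Rightarrow> ('f,'o,'m) closed_open \<Rightarrow> 'f normal_data \<Rightarrow> 'o
     \<Rightarrow> (int \<Rightarrow> 'm \<Rightarrow> 'm) \<Rightarrow> (int \<Rightarrow> 'm \<Rightarrow> 'm) \<Rightarrow> (int \<Rightarrow> 'm \<Rightarrow> 'm) \<Rightarrow> bool" where
  "excision K X U D V R RD G A eZ eX eU \<longleftrightarrow>
     (let AU = FO (pull K (op R)) A; AD = FO (pull K (tube G)) A;
          AV = FO (pull K (op RD)) AD in
      \<forall>k. eZ k \<in> iso (supp_coh K X R A k) (supp_coh K D RD AD k) \<and>
          eX k \<in> iso (coh K X A k) (coh K D AD k) \<and>
          eU k \<in> iso (coh K U AU k) (coh K V AV k) \<and>
          (\<forall>x \<in> carrier (supp_coh K X R A k).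
             eX k (forg K X R A k x) = forg K D RD AD k (eZ k x)) \<and>
          (\<forall>x \<in> carrier (coh K X A k).
             eU k (res K (op R) A k x) = res K (op RD) AD k (eX k x)) \<and>
          (\<forall>y \<in> carrier (coh K U AU (k - 1)).
             eZ k (delta K X U R A k y) = delta K D V RD AD k (eU (k - 1) y)))"

definition thom_isomorphism ::
  "('s,'f,'o,'m) coefficients \<Rightarrow> 's \<Rightarrow> 's \<Rightarrow> ('f,'o,'m) closed_open \<Rightarrow> nat \<Rightarrow> 'o
     \<Rightarrow> (int \<Rightarrow> 'm \<Rightarrow> 'm) \<Rightarrow> bool" where
  "thom_isomorphism K Z X R r A Th \<longleftrightarrow>
     (\<forall>k. Th k \<in> iso (coh K Z (FO (pull K (cl R)) A) (k - 2 * int r)) (supp_coh K X R A k))"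

text \<open>\<open>gys k = \<pi>\<^sub>* : H\<^sup>k\<^sup>-\<^sup>1(S(N);\<pi>\<^sup>*B) \<rightarrow> H\<^sup>k\<^sup>-\<^sup>2\<^sup>r(Z;B)\<close>, where \<open>B = i\<^sup>*A\<close>.\<close>

definition gysin_exact ::
  "('s,'f,'o,'m) coefficients \<Rightarrow> 's \<Rightarrow> 's \<Rightarrow> 's \<Rightarrow> ('f,'o,'m) closed_open \<Rightarrow> 'f normal_data
     \<Rightarrow> nat \<Rightarrow> 'm \<Rightarrow> 'o \<Rightarrow> (int \<Rightarrow> 'm \<Rightarrow> 'm) \<Rightarrow> bool" where
  "gysin_exact K Z D S RD G r th B gys \<longleftrightarrow>
     (let BS = FO (pull K (sph G)) B; e = cup_euler K Z D RD r th B; p = res K (sph G) B in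
      \<forall>k. exact_at (coh K S BS (k - 1)) (gys k) (coh K Z B (k - 2 * int r)) (e k) (coh K Z B k) \<and>
          exact_at (coh K Z B (k - 2 * int r)) (e k) (coh K Z B k) (p k) (coh K S BS k) \<and>
          exact_at (coh K Z B k) (p k) (coh K S BS k) (gys (k + 1))
            (coh K Z B (k + 1 - 2 * int r)))"

text \<open>
  The localisation sequence of \<open>(D(N), D(N) - Z)\<close> is identified with the Gysin sequence, by the
  Thom isomorphism followed by excision on the supported terms, and by isomorphisms \<open>hD\<close>, \<open>hS\<close> on
  the cohomology of \<open>D(N)\<close> and of \<open>D(N) - Z\<close>.
\<close>

definition gysin_identification ::
  "('s,'f,'o,'m) coefficients \<Rightarrow> 's \<Rightarrow> 's \<Rightarrow> 's \<Rightarrow> 's \<Rightarrow> ('f,'o,'m) closed_open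
     \<Rightarrow> ('f,'o,'m) closed_open \<Rightarrow> 'f normal_data \<Rightarrow> nat \<Rightarrow> 'm \<Rightarrow> 'o \<Rightarrow> (int \<Rightarrow> 'm \<Rightarrow> 'm)
     \<Rightarrow> (int \<Rightarrow> 'm \<Rightarrow> 'm) \<Rightarrow> (int \<Rightarrow> 'm \<Rightarrow> 'm)
     \<Rightarrow> (int \<Rightarrow> 'm \<Rightarrow> 'm) \<Rightarrow> (int \<Rightarrow> 'm \<Rightarrow> 'm) \<Rightarrow> bool" where
  "gysin_identification K Z D V S R RD G r th A gys eZ Th hD hS \<longleftrightarrow>
     (let B = FO (pull K (cl R)) A; AD = FO (pull K (tube G)) A;
          AV = FO (pull K (op RD)) AD; BS = FO (pull K (sph G)) B in
      \<forall>k. hD k \<in> iso (coh K D AD k) (coh K Z B k) \<and>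
          hS k \<in> iso (coh K V AV k) (coh K S BS k) \<and>
          (\<forall>x \<in> carrier (coh K Z B (k - 2 * int r)).
             hD k (forg K D RD AD k (eZ k (Th k x))) = cup_euler K Z D RD r th B k x) \<and>
          (\<forall>x \<in> carrier (coh K D AD k).
             hS k (res K (op RD) AD k x) = res K (sph G) B k (hD k x)) \<and>
          (\<forall>y \<in> carrier (coh K V AV (k - 1)).
             delta K D V RD AD k y = eZ k (Th k (gys k (hS (k - 1) y)))))"

end

theory Submission
  imports Defs
begin

text \<open>
  Excision followed by the identification with the Gysin sequence gives
  \<open>\<delta> = Th \<circ> \<pi>\<^sub>* \<circ> (iso)\<close>, so \<open>im \<delta>\<close> is the image under \<open>Th\<close> of
  \<open>im \<pi>\<^sub>* = ker (\<union> e(N))\<close>.  The same identification turns \<open>forg \<circ> Th\<close> into \<open>\<union> e(N)\<close> and \<open>j\<^sup>*\<close>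
  into \<open>\<pi>\<^sup>*\<close>: exactness at \<open>H\<^sup>d(Z;i\<^sup>*A)\<close> yields a lift of \<open>c\<close>, and injectivity of the Euler
  multiplication makes it unique.  Since the comparison maps are injective only on their carriers,
  the point to check is that \<open>forg\<close> and \<open>\<delta>\<close> take values in the expected Hom groups.
\<close>

section \<open>Arrows and iterated shifts\<close>

context category_axs
begin

lemma Hom_ob: "f \<in> Hom C a b \<Longrightarrow> a \<in> Ob C \<and> b \<in> Ob C"
  using dom_cod by (auto simp: Hom_def)

lemma inverse_arrows_unique:
  assumes "inverse_arrows C f g" "inverse_arrows C f h"
  shows "g = h"
proof -
  let ?a = "Dom C f" and ?b = "Cod C f"
  have f: "f \<in> Hom C ?a ?b" and g: "g \<in> Hom C ?b ?a" and h: "h \<in> Hom C ?b ?a"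
    and gf: "g \<cdot> f = Id C ?a" and fh: "f \<cdot> h = Id C ?b"
    using assms by (auto simp: inverse_arrows_def Hom_def)
  have "g = g \<cdot> (f \<cdot> h)" using id_right[OF g] fh by simp
  also have "\<dots> = (g \<cdot> f) \<cdot> h" using cmp_assoc[OF h f g] by simp
  also have "\<dots> = h" using id_left[OF h] gf by simp
  finally show ?thesis .
qed

text \<open>\<open>inv_arrow\<close> is a definite description, so nothing can be said about it
  before two-sided inverses are known to be unique.\<close>

lemma inv_arrow_arr:
  assumes "iso_arrow C f" "f \<in> Hom C a b"
  shows "inv_arrow C f \<in> Hom C b a"
proof -
  have "inverse_arrows C f (inv_arrow C f)"
    unfolding inv_arrow_def
    using assms(1) inverse_arrows_unique unfolding iso_arrow_def by (metis (no_types, lifting) theI)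
  then show ?thesis using assms(2) by (auto simp: inverse_arrows_def Hom_def)
qed

end

lemma funpow_functor_arr:
  assumes "functor_axs C C F" "f \<in> Hom C a b"
  shows "(FA F ^^ n) f \<in> Hom C ((FO F ^^ n) a) ((FO F ^^ n) b)"
  using assms(2) functor_axs.fun_arr[OF assms(1)] by (induction n) auto

lemma funpow_functor_ob:
  assumes "functor_axs C C F" "a \<in> Ob C"
  shows "(FO F ^^ n) a \<in> Ob C"
  using assms(2) functor_axs.fun_ob[OF assms(1)] by (induction n) auto

context triangulated_category
begin

lemma shO_ob: "a \<in> Ob C \<Longrightarrow> shO C k a \<in> Ob C"
  using funpow_functor_ob[OF sh_functor(1)] funpow_functor_ob[OF sh_functor(2)]
  by (simp add: shO_def)

lemma shA_arr: "f \<in> Hom C a b \<Longrightarrow> shA C k f \<in> Hom C (shO C k a) (shO C k b)"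
  using funpow_functor_arr[OF sh_functor(1)] funpow_functor_arr[OF sh_functor(2)]
  by (simp add: shO_def shA_def)

text \<open>Since the translation has a strict inverse, the two iterated shifts agree as objects and
  not only up to isomorphism. This is what lets a boundary map leaving degree \<open>k - 1\<close>
  arrive in degree \<open>k\<close>.\<close>

lemma shO_Sh:
  assumes "a \<in> Ob C"
  shows "shO C (k - 1) (FO (Sh C) a) = shO C k a"
proof (cases "1 \<le> k")
  case True
  then have "nat k = Suc (nat (k - 1))" by simp
  with True show ?thesis by (simp add: shO_def funpow_swap1)
next
  case False
  \<comment> \<open>For k \<le> 0 the shift by \<open>k - 1\<close> applies \<open>ShI\<close>
    exactly \<open>1 - k\<close> times, and the innermost application cancels
    \<open>Sh\<close>.\<close>
  then have "nat (1 - k) = Suc (nat (- k))" by simp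
  with False have "shO C (k - 1) (FO (Sh C) a) = (FO (ShI C) ^^ nat (- k)) a"
    using sh_inv_ob[OF assms] by (simp add: shO_def funpow_swap1)
  \<comment> \<open>At k = 0 the definition of \<open>shO\<close> has already switched to its
    \<open>Sh\<close> branch; both branches are then zero-fold iterates.\<close>
  also have "\<dots> = shO C k a" using False by (auto simp: shO_def)
  finally show ?thesis .
qed

lemma Tri_arr:
  assumes "(f, g, h) \<in> Tri C" "f \<in> Hom C a b" "g \<in> Hom C b c"
  shows "h \<in> Hom C c (FO (Sh C) a)"
  using tri_candidate[OF assms(1)] assms(2,3) by (simp add: candidate_def Hom_def)

end

context exact_functor
begin

lemma kap_pos_arr:
  assumes C: "triangulated_category C" and D: "triangulated_category D" and a: "a \<in> Ob C"
  shows "kap_pos C D F n a \<in> Hom D (FO F ((FO (Sh C) ^^ n) a)) ((FO (Sh D) ^^ n) (FO F a))"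
proof -
  interpret C: triangulated_category C by (rule C)
  interpret D: triangulated_category D by (rule D)
  interpret SD: functor_axs D D "Sh D" by (rule D.sh_functor)
  show ?thesis
  proof (induction n)
    case 0
    show ?case using D.id_arr fun_ob[OF a] by simp
  next
    case (Suc n)
    have "(FO (Sh C) ^^ n) a \<in> Ob C"
      using funpow_functor_ob[OF C.sh_functor(1) a] .
    from D.cmp_arr[OF ksh_arr[OF this] SD.fun_arr[OF Suc]] show ?case by simp
  qed
qed

text \<open>In the recursion step, with b = a[-n-1], the inverse of \<open>Ksh F b\<close> runs from
  \<open>Sh (F b)\<close> to F(a[-n]), because \<open>Sh b\<close> is a[-n] on the nose. Applying
  \<open>ShI\<close> makes it start at F b, ready for the desuspended comparison of stage n.\<close>

lemma kap_neg_arr: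
  assumes C: "triangulated_category C" and D: "triangulated_category D" and a: "a \<in> Ob C"
  shows "kap_neg C D F n a \<in> Hom D (FO F ((FO (ShI C) ^^ n) a)) ((FO (ShI D) ^^ n) (FO F a))"
proof -
  interpret C: triangulated_category C by (rule C)
  interpret D: triangulated_category D by (rule D)
  interpret SD: functor_axs D D "ShI D" by (rule D.sh_functor)
  show ?thesis
  proof (induction n)
    case 0
    show ?case using D.id_arr fun_ob[OF a] by simp
  next
    case (Suc n)
    let ?b = "(FO (ShI C) ^^ Suc n) a"
    have b: "?b \<in> Ob C" and "(FO (ShI C) ^^ n) a \<in> Ob C"
      using funpow_functor_ob[OF C.sh_functor(2) a] by blast+
    then have Sh_b: "FO (Sh C) ?b = (FO (ShI C) ^^ n) a" using C.sh_inv_ob by simp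
    have "FO (ShI D) (FO (Sh D) (FO F ?b)) = FO F ?b" using D.sh_inv_ob fun_ob[OF b] by simp
    with SD.fun_arr[OF D.inv_arrow_arr[OF ksh_iso[OF b] ksh_arr[OF b]]]
    have "FA (ShI D) (inv_arrow D (Ksh F ?b))
            \<in> Hom D (FO F ?b) (FO (ShI D) (FO F ((FO (ShI C) ^^ n) a)))"
      unfolding Sh_b by simp
    from D.cmp_arr[OF this SD.fun_arr[OF Suc]] show ?case by simp
  qed
qed

lemma kap_arr:
  assumes "triangulated_category C" "triangulated_category D" "a \<in> Ob C"
  shows "kap C D F k a \<in> Hom D (FO F (shO C k a)) (shO D k (FO F a))"
  using kap_pos_arr[OF assms] kap_neg_arr[OF assms] by (simp add: kap_def shO_def)

end

section \<open>The maps of the localisation sequence\<close>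

context coefficient_system
begin

lemma coeff_triangulated: "X \<in> Ob (Sp K) \<Longrightarrow> triangulated_category (Cf K X)"
  using coeff_cat tensor_triangulated.axioms(1) by blast

lemma unit_ob: "X \<in> Ob (Sp K) \<Longrightarrow> unit (Cf K X) \<in> Ob (Cf K X)"
  using coeff_cat symmetric_monoidal.unit_ob tensor_triangulated.axioms(2) by blast

lemma pull_ob:
  assumes "f \<in> Hom (Sp K) X Y" "B \<in> Ob (Cf K Y)"
  shows "FO (pull K f) B \<in> Ob (Cf K X)"
proof -
  interpret exact_adjunction "Cf K Y" "Cf K X" "pull K f" "push K f" "punit K f" "pcounit K f"
    using pull_push[OF assms(1)] .
  show ?thesis using L.fun_ob[OF assms(2)] .
qed

lemma coh_group:
  assumes "X \<in> Ob (Sp K)" "B \<in> Ob (Cf K X)"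
  shows "group (coh K X B k)"
proof -
  interpret triangulated_category "Cf K X" using coeff_triangulated[OF assms(1)] .
  show ?thesis
    using hom_abelian[OF unit_ob[OF assms(1)] shO_ob[OF assms(2)]]
    by (simp add: coh_def comm_group.axioms(2))
qed

end

lemma carrier_coh: "carrier (coh K X B k) = Hom (Cf K X) (unit (Cf K X)) (shO (Cf K X) k B)"
  by (simp add: coh_def hom_group_def)

text \<open>Kept general because two pairs are needed: (X, U) and the disk-bundle pair (D(N), D(N) -
  Z).\<close>

locale coefficient_recollement = coefficient_system K + recollement K Z X U R
  for K :: "('s,'f,'o,'m) coefficients" and Z X U :: 's and R :: "('f,'o,'m) closed_open"
begin

lemma space_ob: "Z \<in> Ob (Sp K)" "X \<in> Ob (Sp K)" "U \<in> Ob (Sp K)"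
  using category_axs.Hom_ob[OF spaces cl_arr] category_axs.Hom_ob[OF spaces op_arr] by auto

sublocale CX: triangulated_category "Cf K X"
  by (rule coeff_triangulated[OF space_ob(2)])

sublocale CU: triangulated_category "Cf K U"
  by (rule coeff_triangulated[OF space_ob(3)])

sublocale i: exact_adjunction "Cf K Z" "Cf K X" "push K (cl R)" "ups R" "ups_unit R" "ups_counit R"
  by (rule adj_ups)

sublocale j: exact_adjunction "Cf K X" "Cf K U" "pull K (op R)" "push K (op R)"
    "punit K (op R)" "pcounit K (op R)"
  by (rule pull_push[OF op_arr])

sublocale jm: symmetric_monoidal_exact_functor "Cf K X" "Cf K U" "pull K (op R)"
    "pmu K (op R)" "peps K (op R)"
  by (rule pull_monoidal[OF op_arr])

lemma supp_obj_ob: "B \<in> Ob (Cf K X) \<Longrightarrow> supp_obj K R B \<in> Ob (Cf K X)"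
  by (simp add: supp_obj_def i.L.fun_ob i.R.fun_ob)

lemma forg_carrier:
  assumes "B \<in> Ob (Cf K X)" "x \<in> carrier (supp_coh K X R B k)"
  shows "forg K X R B k x \<in> carrier (coh K X B k)"
  using CX.cmp_arr[OF _ CX.shA_arr[OF i.cu_arr[OF assms(1)]]] assms(2)
  by (simp add: forg_def supp_coh_def carrier_coh supp_obj_def)

text \<open>The type of \<open>bdr\<close> is read off from the distinguished triangle containing
  it, whose other two arrows are a counit and a unit with known ends.\<close>

lemma bdr_arr:
  assumes "B \<in> Ob (Cf K X)"
  shows "bdr R B \<in> Hom (Cf K X) (FO (push K (op R)) (FO (pull K (op R)) B))
                                 (FO (Sh (Cf K X)) (supp_obj K R B))"
  using CX.Tri_arr[OF tri_right i.cu_arr j.un_arr] assms by (simp add: supp_obj_def)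

lemma to_open_arr:
  assumes B: "B \<in> Ob (Cf K X)" and y: "y \<in> carrier (coh K U (FO (pull K (op R)) B) k)"
  shows "to_open K X U R B k y \<in> Hom (Cf K X) (unit (Cf K X))
           (shO (Cf K X) k (FO (push K (op R)) (FO (pull K (op R)) B)))"
proof -
  have "punit K (op R) (unit (Cf K X)) \<in> Hom (Cf K X) (unit (Cf K X))
          (FO (push K (op R)) (FO (pull K (op R)) (unit (Cf K X))))"
    by (rule j.un_arr[OF unit_ob[OF space_ob(2)]])
  moreover have "inv_arrow (Cf K U) (peps K (op R))
      \<in> Hom (Cf K U) (FO (pull K (op R)) (unit (Cf K X))) (unit (Cf K U))"
    using CU.inv_arrow_arr jm.ep_iso by blast
  moreover have "y \<in> Hom (Cf K U) (unit (Cf K U)) (shO (Cf K U) k (FO (pull K (op R)) B))"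
    using y by (simp add: carrier_coh)
  moreover have "kap (Cf K U) (Cf K X) (push K (op R)) k (FO (pull K (op R)) B)
      \<in> Hom (Cf K X) (FO (push K (op R)) (shO (Cf K U) k (FO (pull K (op R)) B)))
          (shO (Cf K X) k (FO (push K (op R)) (FO (pull K (op R)) B)))"
    by (intro j.R.kap_arr CU.triangulated_category_axioms CX.triangulated_category_axioms
        j.L.fun_ob B)
  ultimately show ?thesis
    unfolding to_open_def by (meson CX.cmp_arr j.R.fun_arr)
qed

text \<open>The shift by \<open>k - 1\<close> in \<open>delta\<close> and the extra
  \<open>Sh\<close> in the target of \<open>bdr\<close> combine to a shift by
  \<open>k\<close>.\<close>

lemma delta_carrier:
  assumes B: "B \<in> Ob (Cf K X)"
    and y: "y \<in> carrier (coh K U (FO (pull K (op R)) B) (k - 1))"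
  shows "delta K X U R B k y \<in> carrier (supp_coh K X R B k)"
  using CX.cmp_arr[OF to_open_arr[OF B y] CX.shA_arr[OF bdr_arr[OF B]]]
    CX.shO_Sh[OF supp_obj_ob[OF B]]
  by (simp add: delta_def supp_coh_def carrier_coh)

end

section \<open>Comparison with the Gysin sequence\<close>

lemma iso_inj: "h \<in> iso G H \<Longrightarrow> x \<in> carrier G \<Longrightarrow> y \<in> carrier G \<Longrightarrow> h x = h y \<Longrightarrow> x = y"
  by (auto simp: iso_def bij_betw_def dest: inj_onD)

lemma iso_image: "h \<in> iso G H \<Longrightarrow> h ` carrier G = carrier H"
  by (simp add: iso_def bij_betw_def)

lemma iso_one: "h \<in> iso G H \<Longrightarrow> group G \<Longrightarrow> group H \<Longrightarrow> h \<one>\<^bsub>G\<^esub> = \<one>\<^bsub>H\<^esub>"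
  by (simp add: iso_def hom_one)

theorem proposition4p8:
  fixes K :: "('s,'f,'o,'m) coefficients"
    and Z X U N D V S :: 's
    and R RD :: "('f,'o,'m) closed_open"
    and G :: "'f normal_data"
    and r :: nat and th :: 'm and A :: 'o and d :: int
    and Th eZ eX eU gys hD hS :: "int \<Rightarrow> 'm \<Rightarrow> 'm"
  assumes "coefficient_system K"
    and "recollement K Z X U R"
    and "normal_geometry (Sp K) Z X U N D V S (cl R) (op R) G"
    and "recollement K Z D V RD" and "cl RD = dzero G" and "op RD = dopen G"
    and "thom_class K Z D RD r th"
    and "A \<in> Ob (Cf K X)"
    and "excision K X U D V R RD G A eZ eX eU"
    and "thom_isomorphism K Z X R r A Th"
    and "gysin_exact K Z D S RD G r th (FO (pull K (cl R)) A) gys"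
    and "gysin_identification K Z D V S R RD G r th A gys eZ Th hD hS"
  shows "delta K X U R A d ` carrier (coh K U (FO (pull K (op R)) A) (d - 1)) =
           Th d ` kernel (coh K Z (FO (pull K (cl R)) A) (d - 2 * int r))
                         (coh K Z (FO (pull K (cl R)) A) d)
                         (cup_euler K Z D RD r th (FO (pull K (cl R)) A) d)
       \<and> (inj_on (cup_euler K Z D RD r th (FO (pull K (cl R)) A) d)
                 (carrier (coh K Z (FO (pull K (cl R)) A) (d - 2 * int r)))
           \<longrightarrow> (\<forall>c \<in> carrier (coh K X A d).
                  res K (op R) A d c = \<one>\<^bsub>coh K U (FO (pull K (op R)) A) d\<^esub>
                  \<longrightarrow> (\<exists>!c'. c' \<in> Lift K X R A d c)))"
proof -
  let ?i = "FO (pull K (cl R)) A"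
  let ?AU = "FO (pull K (op R)) A" and ?AD = "FO (pull K (tube G)) A"
  let ?AV = "FO (pull K (op RD)) ?AD" and ?BS = "FO (pull K (sph G)) ?i"
  let ?HZ = "coh K Z ?i (d - 2 * int r)" and ?HZ' = "coh K Z ?i d"
  let ?e = "cup_euler K Z D RD r th ?i d" and ?p = "res K (sph G) ?i d"
  let ?forgX = "forg K X R A d" and ?forgD = "forg K D RD ?AD d"
  interpret coefficient_system K by fact
  interpret X: coefficient_recollement K Z X U R
    using assms(1,2) by (rule coefficient_recollement.intro)
  interpret D: coefficient_recollement K Z D V RD
    using assms(1,4) by (rule coefficient_recollement.intro)
  interpret normal_geometry "Sp K" Z X U N D V S "cl R" "op R" G by fact
  note A = \<open>A \<in> Ob (Cf K X)\<close>
  have AU: "?AU \<in> Ob (Cf K U)" and AD: "?AD \<in> Ob (Cf K D)" and B: "?i \<in> Ob (Cf K Z)"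
    using pull_ob[OF X.op_arr A] pull_ob[OF tube_arr A] pull_ob[OF X.cl_arr A] by auto
  have AV: "?AV \<in> Ob (Cf K V)" and BS: "?BS \<in> Ob (Cf K S)"
    using pull_ob[OF D.op_arr AD] pull_ob[OF sph_arr B] by auto
  have S: "S \<in> Ob (Sp K)" using category_axs.Hom_ob[OF spaces sph_arr] by simp

  have Th: "Th d \<in> iso ?HZ (supp_coh K X R A d)"
    using assms(10) by (simp add: thom_isomorphism_def)
  have eZ: "eZ d \<in> iso (supp_coh K X R A d) (supp_coh K D RD ?AD d)"
    and eX: "eX d \<in> iso (coh K X A d) (coh K D ?AD d)"
    and eU: "\<And>k. eU k \<in> iso (coh K U ?AU k) (coh K V ?AV k)"
    and e_forg: "\<And>x. x \<in> carrier (supp_coh K X R A d) \<Longrightarrow> eX d (?forgX x) = ?forgD (eZ d x)"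
    and e_res: "\<And>x. x \<in> carrier (coh K X A d) \<Longrightarrow>
          eU d (res K (op R) A d x) = res K (op RD) ?AD d (eX d x)"
    and e_delta: "\<And>y. y \<in> carrier (coh K U ?AU (d - 1)) \<Longrightarrow>
          eZ d (delta K X U R A d y) = delta K D V RD ?AD d (eU (d - 1) y)"
    using assms(9) by (auto simp: excision_def Let_def)
  have hD: "hD d \<in> iso (coh K D ?AD d) ?HZ'"
    and hS: "\<And>k. hS k \<in> iso (coh K V ?AV k) (coh K S ?BS k)"
    and h_forg: "\<And>x. x \<in> carrier ?HZ \<Longrightarrow> hD d (?forgD (eZ d (Th d x))) = ?e x"
    and h_res: "\<And>x. x \<in> carrier (coh K D ?AD d) \<Longrightarrow>
          hS d (res K (op RD) ?AD d x) = ?p (hD d x)"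
    and h_delta: "\<And>y. y \<in> carrier (coh K V ?AV (d - 1)) \<Longrightarrow>
          delta K D V RD ?AD d y = eZ d (Th d (gys d (hS (d - 1) y)))"
    using assms(12) by (auto simp: gysin_identification_def Let_def)
  have "exact_at (coh K S ?BS (d - 1)) (gys d) ?HZ ?e ?HZ'"
    and "exact_at ?HZ ?e ?HZ' ?p (coh K S ?BS d)"
    using assms(11) by (auto simp: gysin_exact_def Let_def)
  then have gys: "gys d \<in> hom (coh K S ?BS (d - 1)) ?HZ"
    and im_gys: "gys d ` carrier (coh K S ?BS (d - 1)) = kernel ?HZ ?HZ' ?e"
    and im_e: "?e ` carrier ?HZ = kernel ?HZ' (coh K S ?BS d) ?p"
    by (auto simp: exact_at_def)

  have "delta K X U R A d y = Th d (gys d (hS (d - 1) (eU (d - 1) y)))"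
    if y: "y \<in> carrier (coh K U ?AU (d - 1))" for y
  \<comment> \<open>The Gysin description of the boundary is available only on the disk-bundle pair,
    so the two sides are compared after applying \<open>eZ d\<close>, which is injective on the
    supported group.\<close>
  proof (rule iso_inj[OF eZ])
    have ey: "eU (d - 1) y \<in> carrier (coh K V ?AV (d - 1))"
      using iso_image[OF eU] y by blast
    then have "hS (d - 1) (eU (d - 1) y) \<in> carrier (coh K S ?BS (d - 1))"
      using iso_image[OF hS] by blast
    then show "Th d (gys d (hS (d - 1) (eU (d - 1) y))) \<in> carrier (supp_coh K X R A d)"
      using iso_image[OF Th] hom_carrier[OF gys] by blast
    show "delta K X U R A d y \<in> carrier (supp_coh K X R A d)"
      by (rule X.delta_carrier[OF A y])
    show "eZ d (delta K X U R A d y) = eZ d (Th d (gys d (hS (d - 1) (eU (d - 1) y))))"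
      using e_delta[OF y] h_delta[OF ey] by simp
  qed
  then have "delta K X U R A d ` carrier (coh K U ?AU (d - 1)) =
      Th d ` gys d ` hS (d - 1) ` eU (d - 1) ` carrier (coh K U ?AU (d - 1))"
    by (simp add: image_image)
  \<comment> \<open>\<open>eU\<close> and \<open>hS\<close> are onto, so precomposing with them
    leaves the whole image of \<open>gys d\<close>, which exactness identifies with the Euler
    kernel.\<close>
  then have image_delta: "delta K X U R A d ` carrier (coh K U ?AU (d - 1)) =
      Th d ` kernel ?HZ ?HZ' ?e"
    by (simp only: iso_image[OF eU] iso_image[OF hS] im_gys)

  \<comment> \<open>Euler multiplication is \<open>forg\<close> after \<open>Th d\<close>, up to
    \<open>eX\<close> and \<open>hD\<close>. Existence and uniqueness of the lift both rest on
    this.\<close>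
  have e_Th: "?e x = hD d (eX d (?forgX (Th d x)))" if "x \<in> carrier ?HZ" for x
    using h_forg[OF that] e_forg[of "Th d x"] imageI[OF that, of "Th d"] iso_image[OF Th] by simp

  have lift: "\<exists>!c'. c' \<in> Lift K X R A d c"
    if inj: "inj_on ?e (carrier ?HZ)" and c: "c \<in> carrier (coh K X A d)"
      and c0: "res K (op R) A d c = \<one>\<^bsub>coh K U ?AU d\<^esub>" for c
  proof -
    have xD: "eX d c \<in> carrier (coh K D ?AD d)" using iso_image[OF eX] c by blast
    \<comment> \<open>The vanishing of the restriction of \<open>c\<close> to U is carried through
      both comparison squares; the isomorphisms preserve the neutral element.\<close>
    have "?p (hD d (eX d c)) = hS d (eU d \<one>\<^bsub>coh K U ?AU d\<^esub>)"
      using h_res[OF xD] e_res[OF c] c0 by simp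
    also have "\<dots> = \<one>\<^bsub>coh K S ?BS d\<^esub>"
      using iso_one[OF eU coh_group[OF X.space_ob(3) AU] coh_group[OF D.space_ob(3) AV]]
        iso_one[OF hS coh_group[OF D.space_ob(3) AV] coh_group[OF S BS]] by simp
    finally have "hD d (eX d c) \<in> kernel ?HZ' (coh K S ?BS d) ?p"
      using iso_image[OF hD] xD by (auto simp: kernel_def)
    \<comment> \<open>Exactness at the middle term H^d(Z; i^*A) produces \<open>z\<close>; the lift
      will be its Thom image \<open>Th d z\<close>.\<close>
    then obtain z where z: "z \<in> carrier ?HZ" and ez: "hD d (eX d c) = ?e z"
      using im_e by blast
    have Thz: "Th d z \<in> carrier (supp_coh K X R A d)" using iso_image[OF Th] z by blast
    then have fz: "?forgX (Th d z) \<in> carrier (coh K X A d)" by (rule X.forg_carrier[OF A])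
    then have exD: "eX d (?forgX (Th d z)) \<in> carrier (coh K D ?AD d)" using iso_image[OF eX] by blast
    have "eX d (?forgX (Th d z)) = eX d c"
      using e_Th[OF z] ez by (intro iso_inj[OF hD exD xD]) simp
    then have "?forgX (Th d z) = c" by (rule iso_inj[OF eX fz c])
    then have "Th d z \<in> Lift K X R A d c" using Thz by (simp add: Lift_def)
    moreover have "c' = Th d z" if c': "c' \<in> Lift K X R A d c" for c'
    proof -
      have fc': "?forgX c' = c" and "c' \<in> carrier (supp_coh K X R A d)"
        using c' by (simp_all add: Lift_def)
      \<comment> \<open>Surjectivity of the Thom map makes every lift a Thom image. Two lifts of
        \<open>c\<close> have preimages with the same Euler multiple, and this is where injectivity
        enters.\<close>
      then obtain x where x: "x \<in> carrier ?HZ" "c' = Th d x"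
        using iso_image[OF Th] by blast
      have "?e x = ?e z"
        using e_Th[OF x(1)] fc' x(2) ez by simp
      then show ?thesis using inj_onD[OF inj _ x(1) z] x(2) by simp
    qed
    ultimately show ?thesis by (rule ex1I)
  qed
  from image_delta lift show ?thesis by (intro conjI impI ballI)
qed

end
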